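(* Let $B$ be a non-trivial Boolean algebra. For an ultracontact $\mathscr K$ on $B$ put $\mathscr S_{\mathscr K}=\{{\uparrow}F: F\in\mathscr K\}$, and for a stack system $\mathscr S$ on $B$ put $\mathscr K_{\mathscr S}=\{F\subseteq B: {\uparrow}F\in\mathscr S\}$. Then $\mathscr S_{\mathscr K}$ is a stack system, $\mathscr K_{\mathscr S}$ is an ultracontact, and the maps $\mathscr K\mapsto\mathscr S_{\mathscr K}$ and $\mathscr S\mapsto\mathscr K_{\mathscr S}$ are mutually inverse, i.e. $\mathscr K=\mathscr K_{\mathscr S_{\mathscr K}}$ and $\mathscr S=\mathscr S_{\mathscr K_{\mathscr S}}$ for every ultracontact $\mathscr K$ and every stack system $\mathscr S$ on $B$. Hence there is a one-to-one correspondence between ultracontacts and stack systems on $B$.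
   Context: Let $B$ be a non-trivial Boolean algebra with order $\le$ and join $+$. For $F\subseteq B$, ${\uparrow}F=\{y\in B: x\le y \text{ for some } x\in F\}$ and ${\uparrow}x={\uparrow}\{x\}$. A stack of $B$ is an upward closed subset of $B$; $\mathrm{Stack}(B)$ is the set of stacks. For $F,G\subseteq B$ put $F+G=\{f+g: f\in F,\ g\in G\}$, and write $F\preceq G$ iff for every $g\in G$ there is $f\in F$ with $f\le g$. An ultracontact on $B$ is a family $\mathscr K\subseteq 2^B$ such that for all $F,G\subseteq B$: (K0) $\emptyset\notin\mathscr K$; (K1) if $0\in F$ then $F\notin\mathscr K$; (K2) if $x\neq 0$ then $\{x\}\in\mathscr K$; (K3) if $F\preceq G$, $G\neq\emptyset$ and $F\in\mathscr K$, then $G\in\mathscr K$; (K4) if $F+G\in\mathscr K$ then $F\in\mathscr K$ or $G\in\mathscr K$. A stack system on $B$ is a family $\mathscr S\subseteq\mathrm{Stack}(B)$ such that for all $U,V\in\mathrm{Stack}(B)$ and $x\in B$: (SS0) $\emptyset\notin\mathscr S$; (SS1) $B\notin\mathscr S$; (SS2) if $x\neq0$ then ${\uparrow}x\in\mathscr S$; (SS3) if $\emptyset\neq U\subseteq V$ and $V\in\mathscr S$ then $U\in\mathscr S$; (SS4) if $U\cap V\in\mathscr S$ then $U\in\mathscr S$ or $V\in\mathscr S$. *)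

theory Defs
  imports Main
begin

text \<open>
  The Boolean algebra \<open>B\<close> is the whole type \<open>'a :: boolean_algebra\<close>, with join \<open>sup\<close>, least element \<open>bot\<close>
  and carrier \<open>UNIV\<close>. This class admits the one-element algebra, so non-triviality (\<open>bot \<noteq> top\<close>)
  has to be assumed where it is wanted.
\<close>

definition up :: "'a::boolean_algebra set \<Rightarrow> 'a set" where
  "up F = {y. \<exists>x\<in>F. x \<le> y}"

text \<open>The empty set counts as a stack.\<close>

definition Stack :: "'a::boolean_algebra set set" where
  "Stack = {U. \<forall>x\<in>U. \<forall>y. x \<le> y \<longrightarrow> y \<in> U}"

definition set_join :: "'a::boolean_algebra set \<Rightarrow> 'a set \<Rightarrow> 'a set"  (infixl "[+]" 65) where
  "F [+] G = {sup f g | f g. f \<in> F \<and> g \<in> G}"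

definition prec_set :: "'a::boolean_algebra set \<Rightarrow> 'a set \<Rightarrow> bool"  (infix "\<preceq>" 50) where
  "F \<preceq> G \<longleftrightarrow> (\<forall>g\<in>G. \<exists>f\<in>F. f \<le> g)"

definition ultracontact :: "'a::boolean_algebra set set \<Rightarrow> bool" where
  "ultracontact K \<longleftrightarrow>
     {} \<notin> K \<and>
     (\<forall>F. bot \<in> F \<longrightarrow> F \<notin> K) \<and>
     (\<forall>x. x \<noteq> bot \<longrightarrow> {x} \<in> K) \<and>
     (\<forall>F G. F \<preceq> G \<and> G \<noteq> {} \<and> F \<in> K \<longrightarrow> G \<in> K) \<and>
     (\<forall>F G. F [+] G \<in> K \<longrightarrow> F \<in> K \<or> G \<in> K)"

definition stack_system :: "'a::boolean_algebra set set \<Rightarrow> bool" where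
  "stack_system S \<longleftrightarrow>
     S \<subseteq> Stack \<and>
     {} \<notin> S \<and>
     UNIV \<notin> S \<and>
     (\<forall>x. x \<noteq> bot \<longrightarrow> up {x} \<in> S) \<and>
     (\<forall>U\<in>Stack. \<forall>V\<in>Stack. U \<noteq> {} \<and> U \<subseteq> V \<and> V \<in> S \<longrightarrow> U \<in> S) \<and>
     (\<forall>U\<in>Stack. \<forall>V\<in>Stack. U \<inter> V \<in> S \<longrightarrow> U \<in> S \<or> V \<in> S)"

definition stack_system_of :: "'a::boolean_algebra set set \<Rightarrow> 'a set set" where
  "stack_system_of K = {up F | F. F \<in> K}"

definition ultracontact_of :: "'a::boolean_algebra set set \<Rightarrow> 'a set set" where
  "ultracontact_of S = {F. up F \<in> S}"

end

theory Submission
  imports Defs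
begin

text \<open>
  The relation \<open>F \<preceq> G\<close> is the inclusion \<open>up G \<subseteq> up F\<close>, so (K3) makes membership in an ultracontact
  depend only on the upward closure of a set; and \<open>up (F [+] G) = up F \<inter> up G\<close> turns (K4) into (SS4).
\<close>

lemma up_in_Stack: "up F \<in> Stack"
  by (auto simp: up_def Stack_def intro: order_trans)

lemma up_Stack: "U \<in> Stack \<Longrightarrow> up U = U"
  by (auto simp: up_def Stack_def)

lemma up_eq_empty_iff [simp]: "up F = {} \<longleftrightarrow> F = {}"
  by (auto simp: up_def)

lemma up_eq_UNIV: "bot \<in> F \<Longrightarrow> up F = UNIV"
  unfolding up_def using bot_least by blast

text \<open>The relation says that \<open>G\<close> lies inside \<open>up F\<close>; as
  \<open>up F\<close> is upward closed, it then contains all of \<open>up G\<close>.\<close>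

lemma prec_set_iff: "F \<preceq> G \<longleftrightarrow> up G \<subseteq> up F"
  unfolding up_def prec_set_def by (blast intro: order_trans)

text \<open>Since \<open>sup f g\<close> is the least upper bound, an element lies above it exactly
  when it lies above both \<open>f\<close> and \<open>g\<close>.\<close>

lemma up_set_join: "up (F [+] G) = up F \<inter> up G"
proof (intro equalityI subsetI)
  fix y assume "y \<in> up F \<inter> up G"
  then obtain f g where "f \<in> F" "g \<in> G" "f \<le> y" "g \<le> y"
    by (auto simp: up_def)
  then have "sup f g \<in> F [+] G" "sup f g \<le> y"
    by (auto simp: set_join_def)
  then show "y \<in> up (F [+] G)"
    unfolding up_def by blast
qed (auto simp: up_def set_join_def)

text \<open>Equal closures give \<open>F \<preceq> G\<close> and \<open>G \<preceq> F\<close>, so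
  (K3) transfers membership both ways.\<close>

lemma ultracontact_cong:
  assumes "ultracontact K" and "up F = up G"
  shows "F \<in> K \<longleftrightarrow> G \<in> K"
proof -
  have mono: "Y \<in> K" if "X \<in> K" "X \<preceq> Y" "Y \<noteq> {}" for X Y
    using assms(1) that unfolding ultracontact_def by blast
  \<comment> \<open>(K3) never yields an empty set as a member; if one of the two sets is empty then
    so is the other, and (K0) excludes both.\<close>
  have "F = {} \<longleftrightarrow> G = {}"
    using assms(2) up_eq_empty_iff by metis
  moreover have "{} \<notin> K"
    using assms(1) by (simp add: ultracontact_def)
  ultimately show ?thesis
    using mono[of F G] mono[of G F] assms(2) by (auto simp: prec_set_iff)
qed

text \<open>By idempotence of \<open>up\<close>, \<open>F\<close> and \<open>up F\<close> belong to
  \<open>K\<close> together, and a stack in \<open>K\<close> is the closure of itself. The stack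
  axioms thus become statements about \<open>K\<close>.\<close>

lemma stack_system_of_eq:
  assumes "ultracontact K"
  shows "stack_system_of K = K \<inter> Stack"
proof -
  have "up F \<in> K \<longleftrightarrow> F \<in> K" for F
    by (rule ultracontact_cong[OF assms]) (rule up_Stack[OF up_in_Stack])
  moreover have "U \<in> {up F | F. F \<in> K}" if "U \<in> K" "U \<in> Stack" for U
    using that up_Stack[of U] by force
  ultimately show ?thesis
    by (auto simp: stack_system_of_def up_in_Stack)
qed

lemma stack_system_stack_system_of:
  assumes "ultracontact K"
  shows "stack_system (stack_system_of K)"
proof -
  have up: "up F \<in> K \<longleftrightarrow> F \<in> K" for F
    by (rule ultracontact_cong[OF assms]) (rule up_Stack[OF up_in_Stack])
  have "{} \<notin> K" "UNIV \<notin> K" "\<And>x. x \<noteq> bot \<Longrightarrow> up {x} \<in> K"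
    using assms by (auto simp: ultracontact_def up)
  moreover have "U \<in> K" if "U \<in> Stack" "V \<in> Stack" "U \<noteq> {}" "U \<subseteq> V" "V \<in> K" for U V
  proof -
    \<comment> \<open>Stacks are their own closures, so inclusion of stacks is the reverse of
      \<open>\<preceq>\<close> and (SS3) is an instance of (K3).\<close>
    have "V \<preceq> U"
      using that by (simp add: prec_set_iff up_Stack)
    then show ?thesis
      using assms that unfolding ultracontact_def by blast
  qed
  moreover have "U \<in> K \<or> V \<in> K" if "U \<in> Stack" "V \<in> Stack" "U \<inter> V \<in> K" for U V
  proof -
    \<comment> \<open>The closure of \<open>U [+] V\<close> is \<open>U \<inter> V\<close>, which
      makes (K4) applicable.\<close>
    have "U [+] V \<in> K"
      using that up[of "U [+] V"] by (simp add: up_set_join up_Stack)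
    then show ?thesis
      using assms unfolding ultracontact_def by blast
  qed
  ultimately show ?thesis
    unfolding stack_system_def stack_system_of_eq[OF assms] using up_in_Stack by blast
qed

lemma ultracontact_ultracontact_of:
  assumes "stack_system S"
  shows "ultracontact (ultracontact_of S)"
proof -
  have "up {} \<notin> S" "\<And>F. bot \<in> F \<Longrightarrow> up F \<notin> S" "\<And>x. x \<noteq> bot \<Longrightarrow> up {x} \<in> S"
    using assms by (simp_all add: stack_system_def up_eq_UNIV up_Stack Stack_def)
  moreover have "up G \<in> S" if "F \<preceq> G" "G \<noteq> {}" "up F \<in> S" for F G
  proof -
    \<comment> \<open>The nonemptiness conditions of (K3) and (SS3) match because \<open>up\<close>
      sends only the empty set to the empty set.\<close>
    have "up G \<noteq> {}" "up G \<subseteq> up F"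
      using that by (simp_all add: prec_set_iff)
    then show ?thesis
      using assms \<open>up F \<in> S\<close> up_in_Stack[of F] up_in_Stack[of G] unfolding stack_system_def by blast
  qed
  moreover have "up F \<in> S \<or> up G \<in> S" if "up (F [+] G) \<in> S" for F G
    using assms that up_in_Stack[of F] up_in_Stack[of G]
    by (simp add: stack_system_def up_set_join)
  ultimately show ?thesis
    by (simp add: ultracontact_def ultracontact_of_def) blast
qed

text \<open>A set on the left shares its closure with some member of \<open>K\<close>, hence is
  itself in \<open>K\<close>.\<close>

lemma ultracontact_of_stack_system_of:
  assumes "ultracontact K"
  shows "ultracontact_of (stack_system_of K) = K"
  by (auto simp: ultracontact_of_def stack_system_of_def dest: ultracontact_cong[OF assms])

text \<open>Each member of \<open>S\<close> is a stack, so it occurs on the left as the closure of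
  itself.\<close>

lemma stack_system_of_ultracontact_of:
  assumes "stack_system S"
  shows "stack_system_of (ultracontact_of S) = S"
proof -
  have "U \<in> stack_system_of (ultracontact_of S)" if "U \<in> S" for U
  proof -
    have "up U = U"
      by (rule up_Stack) (use assms that in \<open>auto simp: stack_system_def\<close>)
    then show ?thesis
      using that unfolding ultracontact_of_def stack_system_of_def by force
  qed
  then show ?thesis
    by (auto simp: ultracontact_of_def stack_system_of_def)
qed

theorem theorem8p6:
  assumes "(bot :: 'a::boolean_algebra) \<noteq> top"
  shows "(\<forall>K :: 'a set set. ultracontact K \<longrightarrow> stack_system (stack_system_of K)) \<and>
         (\<forall>S :: 'a set set. stack_system S \<longrightarrow> ultracontact (ultracontact_of S)) \<and>
         (\<forall>K :: 'a set set. ultracontact K \<longrightarrow> K = ultracontact_of (stack_system_of K)) \<and>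
         (\<forall>S :: 'a set set. stack_system S \<longrightarrow> S = stack_system_of (ultracontact_of S)) \<and>
         bij_betw stack_system_of {K :: 'a set set. ultracontact K} {S. stack_system S} \<and>
         bij_betw ultracontact_of {S :: 'a set set. stack_system S} {K. ultracontact K}"
proof -
  have "bij_betw stack_system_of {K :: 'a set set. ultracontact K} {S. stack_system S}"
    by (rule bij_betw_byWitness[where f' = ultracontact_of])
      (auto simp: ultracontact_of_stack_system_of stack_system_of_ultracontact_of
        stack_system_stack_system_of ultracontact_ultracontact_of)
  moreover have "bij_betw ultracontact_of {S :: 'a set set. stack_system S} {K. ultracontact K}"
    by (rule bij_betw_byWitness[where f' = stack_system_of])
      (auto simp: ultracontact_of_stack_system_of stack_system_of_ultracontact_of
        stack_system_stack_system_of ultracontact_ultracontact_of)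
  ultimately show ?thesis
    by (simp add: ultracontact_of_stack_system_of stack_system_of_ultracontact_of
        stack_system_stack_system_of ultracontact_ultracontact_of)
qed

end
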